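(* Let $k\ge 2$ be an integer, and let $G_1$ and $G_2$ be graphs on disjoint vertex sets with $n_1\ge 1$ and $n_2\ge 1$ vertices respectively. Then the $f$-polynomial of the $k$-cut complex of the disjoint union $G_1+G_2$ is \[ f(\Delta_k(G_1+G_2),x)=x^{n_2}f(\Delta_k(G_1),x)+x^{n_1}f(\Delta_k(G_2),x)+\sum_{j=k}^{n_1+n_2}\left(\binom{n_1+n_2}{j}-\binom{n_1}{j}-\binom{n_2}{j}\right)x^{n_1+n_2-j}. \]
   Context: All graphs are finite and simple. For a graph $G=(V,E)$ with $|V|=n$ and an integer $k\ge 2$, the $k$-cut complex $\Delta_k(G)$ is the simplicial complex on $V$ whose facets are exactly the subsets $F\subseteq V$ with $|F|=n-k$ such that the induced subgraph $G[V\setminus F]$ is disconnected (equivalently, $\sigma\subseteq V$ is a face iff $V\setminus\sigma$ contains a $k$-subset inducing a disconnected subgraph). If there are no such $F$, $\Delta_k(G)$ is the void complex (no faces at all). The disjoint union $G_1+G_2$ has vertex set $V_1\sqcup V_2$ and edge set $E_1\sqcup E_2$. The $f$-polynomial of a simplicial complex $\Delta$ is $f(\Delta,x)=\sum_{i\ge 0} f_{i-1}x^i$, where $f_{i-1}$ is the number of faces of cardinality $i$ (so $f_{-1}=1$ for a nonvoid complex); the $f$-polynomial of the void complex is $0$. Binomial coefficients $\binom{a}{j}$ with $j>a$ are $0$. *)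

theory Defs
  imports
    "Graph_Theory.Graph_Theory"
    "HOL-Computational_Algebra.Polynomial"
begin

(* A finite simple graph is an irreflexive symmetric finite digraph without parallel arcs
   (locales graph and pair_graph).  A finite simplicial complex is its set of faces: the void
   complex is {}, whereas {{}} is the complex whose only face is the empty one. *)

definition simplicial_complex_on :: "'a set \<Rightarrow> 'a set set \<Rightarrow> bool" where
  "simplicial_complex_on V \<Delta> \<longleftrightarrow>
     (\<forall>\<sigma>\<in>\<Delta>. \<sigma> \<subseteq> V) \<and> (\<forall>\<sigma>\<in>\<Delta>. \<forall>\<tau>. \<tau> \<subseteq> \<sigma> \<longrightarrow> \<tau> \<in> \<Delta>)"

definition facets :: "'a set set \<Rightarrow> 'a set set" where
  "facets \<Delta> = {\<sigma>\<in>\<Delta>. \<forall>\<tau>\<in>\<Delta>. \<sigma> \<subseteq> \<tau> \<longrightarrow> \<tau> = \<sigma>}"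

definition complex_generated_by :: "'a set set \<Rightarrow> 'a set set" where
  "complex_generated_by \<F> = {\<sigma>. \<exists>F\<in>\<F>. \<sigma> \<subseteq> F}"

(* f_number \<Delta> i counts the faces of cardinality i; it is the number usually written f_{i-1}. *)
definition f_number :: "'a set set \<Rightarrow> nat \<Rightarrow> nat" where
  "f_number \<Delta> i = card {\<sigma>\<in>\<Delta>. card \<sigma> = i}"

(* No face has more than card (\<Union>\<Delta>) elements, so the sum contains all nonzero terms. *)
definition f_polynomial :: "'a set set \<Rightarrow> int poly" where
  "f_polynomial \<Delta> = (\<Sum>i\<le>card (\<Union>\<Delta>). monom (int (f_number \<Delta> i)) i)"

(* The condition |F| = n - k is written |F| + k = n, since truncated subtraction would admit
   F = {} when n < k.  In this library the null graph counts as not connected; for k > 0 the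
   induced subgraph below is never null. *)
definition cut_facets :: "nat \<Rightarrow> ('a, 'b) pre_digraph \<Rightarrow> 'a set set" where
  "cut_facets k G = {F. F \<subseteq> verts G \<and> card F + k = card (verts G) \<and>
     \<not> Digraph_Component.connected (G \<restriction> (verts G - F))}"

definition cut_complex :: "nat \<Rightarrow> ('a, 'b) pre_digraph \<Rightarrow> 'a set set" where
  "cut_complex k G = complex_generated_by (cut_facets k G)"

lemma simplicial_complex_on_cut_complex: "simplicial_complex_on (verts G) (cut_complex k G)"
  by (auto simp: simplicial_complex_on_def cut_complex_def complex_generated_by_def cut_facets_def)

lemma facets_cut_complex:
  assumes "finite (verts G)"
  shows "facets (cut_complex k G) = cut_facets k G"
proof -
  have eq: "F' = F" if F: "F \<in> cut_facets k G" "F' \<in> cut_facets k G" "F \<subseteq> F'" for F F'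
  proof -
    have "finite F'"
      using F(2) assms finite_subset[of F' "verts G"] unfolding cut_facets_def by blast
    moreover have "card F = card F'"
      using F(1,2) unfolding cut_facets_def mem_Collect_eq by linarith
    ultimately show ?thesis
      using card_subset_eq[of F' F] F(3) by blast
  qed
  show ?thesis
  proof (intro equalityI subsetI)
    fix \<sigma> assume \<sigma>: "\<sigma> \<in> facets (cut_complex k G)"
    then obtain F where F: "F \<in> cut_facets k G" "\<sigma> \<subseteq> F"
      unfolding facets_def cut_complex_def complex_generated_by_def by blast
    then have "F \<in> cut_complex k G"
      unfolding cut_complex_def complex_generated_by_def by blast
    with \<sigma> F have "F = \<sigma>"
      unfolding facets_def by blast
    with F show "\<sigma> \<in> cut_facets k G"
      by simp
  next
    fix F assume F: "F \<in> cut_facets k G"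
    then have "F \<in> cut_complex k G"
      unfolding cut_complex_def complex_generated_by_def by blast
    moreover have "\<tau> = F" if \<tau>: "\<tau> \<in> cut_complex k G" "F \<subseteq> \<tau>" for \<tau>
    proof -
      obtain F' where "F' \<in> cut_facets k G" "\<tau> \<subseteq> F'"
        using \<tau>(1) unfolding cut_complex_def complex_generated_by_def by blast
      with \<tau>(2) F eq[of F F'] show ?thesis
        by blast
    qed
    ultimately show "F \<in> facets (cut_complex k G)"
      unfolding facets_def by blast
  qed
qed

lemma cut_complex_iff:
  assumes "finite (verts G)"
  shows "\<sigma> \<in> cut_complex k G \<longleftrightarrow> \<sigma> \<subseteq> verts G \<and>
    (\<exists>W \<subseteq> verts G - \<sigma>. card W = k \<and> \<not> Digraph_Component.connected (G \<restriction> W))"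
    (is "?L \<longleftrightarrow> ?R")
proof
  assume ?L
  then obtain F where F: "F \<in> cut_facets k G" "\<sigma> \<subseteq> F"
    by (auto simp: cut_complex_def complex_generated_by_def)
  then have "F \<subseteq> verts G" "finite F"
    using assms by (auto simp: cut_facets_def intro: finite_subset)
  then have "card (verts G - F) = k"
    using F by (auto simp: cut_facets_def card_Diff_subset)
  then show ?R
    using F by (intro conjI exI[of _ "verts G - F"]) (auto simp: cut_facets_def)
next
  assume ?R
  then obtain W where W: "W \<subseteq> verts G - \<sigma>" "card W = k"
    "\<not> Digraph_Component.connected (G \<restriction> W)" and \<sigma>: "\<sigma> \<subseteq> verts G"
    by blast
  then have sub: "W \<subseteq> verts G" by blast
  then have "card (verts G - W) + k = card (verts G)"
    using W assms by (metis card_Diff_subset card_mono finite_subset le_add_diff_inverse2)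
  moreover have "verts G - (verts G - W) = W"
    using sub by blast
  ultimately have "verts G - W \<in> cut_facets k G"
    using W by (auto simp: cut_facets_def)
  moreover have "\<sigma> \<subseteq> verts G - W"
    using W \<sigma> by blast
  ultimately show ?L
    unfolding cut_complex_def complex_generated_by_def by blast
qed

end

theory Submission
  imports Defs
begin

text \<open>
  A face is recorded by its complement \<open>U\<close>, which has to contain a disconnected \<open>k\<close>-set. A set \<open>U\<close>
  inside one of the two vertex sets contains such a \<open>k\<close>-set for the disjoint union iff it does so for
  the corresponding summand. If \<open>U\<close> meets both vertex sets and has at least \<open>k \<ge> 2\<close> elements, some
  \<open>k\<close>-subset of \<open>U\<close> meets both as well, and no arc joins its two parts. So the sets of the latter kind
  are all counted, and there are \<open>(n\<^sub>1 + n\<^sub>2 choose j) - (n\<^sub>1 choose j) - (n\<^sub>2 choose j)\<close>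
  of them of size \<open>j \<ge> k\<close>.
\<close>

section \<open>Face complements and the f-polynomial\<close>

definition face_complements :: "nat \<Rightarrow> ('a, 'b) pre_digraph \<Rightarrow> 'a set set" where
  "face_complements k G = {U. U \<subseteq> verts G \<and>
     (\<exists>W\<subseteq>U. card W = k \<and> \<not> Digraph_Component.connected (G \<restriction> W))}"

lemma finite_face_complements:
  "finite (verts G) \<Longrightarrow> finite (face_complements k G)"
  unfolding face_complements_def by (rule finite_subset[of _ "Pow (verts G)"]) auto

text \<open>Grouping the faces by cardinality gives the defining sum. As a sum over single faces,
  the polynomial can be moved along bijections and split over disjoint families.\<close>

lemma f_polynomial_eq_sum_faces:
  assumes "finite (\<Union>\<Delta>)"
  shows "f_polynomial \<Delta> = (\<Sum>\<sigma>\<in>\<Delta>. monom 1 (card \<sigma>))"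
proof -
  have fin: "finite \<Delta>"
    using assms by (rule finite_UnionD)
  have "(\<Sum>\<sigma>\<in>\<Delta>. monom (1::int) (card \<sigma>)) =
      (\<Sum>i\<le>card (\<Union>\<Delta>). \<Sum>\<sigma>\<in>{\<sigma>\<in>\<Delta>. card \<sigma> = i}. monom 1 (card \<sigma>))"
    using fin assms by (intro sum.group[symmetric]) (auto intro!: card_mono)
  also have "\<dots> = (\<Sum>i\<le>card (\<Union>\<Delta>). monom (int (f_number \<Delta> i)) i)"
    \<comment> \<open>Every summand of a group is \<open>monom 1 i\<close>, so the group adds up to
      its cardinality times that monomial.\<close>
    by (intro sum.cong refl) (simp add: f_number_def of_nat_poly smult_monom)
  finally show ?thesis
    by (simp add: f_polynomial_def)
qed

lemma f_polynomial_cut_complex: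
  assumes fin: "finite (verts G)"
  shows "f_polynomial (cut_complex k G) =
    (\<Sum>U\<in>face_complements k G. monom 1 (card (verts G) - card U))"
proof -
  have sub: "\<sigma> \<subseteq> verts G" if "\<sigma> \<in> cut_complex k G" for \<sigma>
    using that fin by (simp add: cut_complex_iff)
  have "finite (\<Union>(cut_complex k G))"
    by (rule finite_subset[OF _ fin]) (use sub in blast)
  then have "f_polynomial (cut_complex k G) = (\<Sum>\<sigma>\<in>cut_complex k G. monom 1 (card \<sigma>))"
    by (rule f_polynomial_eq_sum_faces)
  also have "\<dots> = (\<Sum>U\<in>face_complements k G. monom 1 (card (verts G - U)))"
    \<comment> \<open>Complementation in \<open>verts G\<close> is an involution on subsets, so it
      serves as its own inverse.\<close>
    by (rule sum.reindex_bij_witness[where i = "\<lambda>U. verts G - U" and j = "\<lambda>\<sigma>. verts G - \<sigma>"])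
      (auto simp: cut_complex_iff[OF fin] face_complements_def double_diff)
  also have "\<dots> = (\<Sum>U\<in>face_complements k G. monom 1 (card (verts G) - card U))"
    using fin
    by (intro sum.cong refl arg_cong[where f = "monom 1"] card_Diff_subset)
      (auto simp: face_complements_def intro: finite_subset)
  finally show ?thesis .
qed

section \<open>Induced subgraphs of a disjoint union\<close>

lemma union_commute_compatible:
  "compatible G H \<Longrightarrow> union G H = union H G"
  \<comment> \<open>\<open>union\<close> takes \<open>tail\<close> and \<open>head\<close> from its
    first argument; compatibility identifies them with those of the second.\<close>
  by (auto simp: union_def compatible_def)

text \<open>An arc of an induced subgraph has both ends in \<open>W\<close>, whereas an arc of
  \<open>H\<close> has its tail in \<open>verts H\<close>, hence outside \<open>W\<close>.\<close>

lemma induce_subgraph_union_left: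
  assumes "wf_digraph H" "compatible G H" "W \<inter> verts H = {}"
  shows "union G H \<restriction> W = G \<restriction> W"
proof -
  have "tail G e \<notin> W" if "e \<in> arcs H" for e
    using wf_digraph.tail_in_verts[OF assms(1) that] assms(2,3) by (auto simp: compatible_def)
  then show ?thesis
    by (auto simp: induce_subgraph_def union_def)
qed

text \<open>Each arc has both ends in \<open>verts G\<close> or both in \<open>verts H\<close>.
  Membership in \<open>verts G\<close> is therefore constant along undirected walks, and none joins
  the two parts of \<open>W\<close>.\<close>

lemma not_connected_union:
  assumes G: "wf_digraph G" and H: "wf_digraph H"
    and comp: "compatible G H" and disj: "verts G \<inter> verts H = {}"
    and W: "W \<inter> verts G \<noteq> {}" "W \<inter> verts H \<noteq> {}"
  shows "\<not> Digraph_Component.connected (union G H \<restriction> W)"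
proof
  assume conn: "Digraph_Component.connected (union G H \<restriction> W)"
  obtain u v where u: "u \<in> W" "u \<in> verts G" and v: "v \<in> W" "v \<in> verts H"
    using W by blast
  have cross: "y \<in> verts G \<longleftrightarrow> z \<in> verts G"
    if yz: "(y, z) \<in> (arcs_ends (union G H \<restriction> W))\<^sup>s" for y z
  proof -
    obtain e where e: "e \<in> arcs G \<union> arcs H"
      "(y, z) = (tail G e, head G e) \<or> (z, y) = (tail G e, head G e)"
      using yz by (auto simp: symcl_def arcs_ends_def arc_to_ends_def induce_subgraph_def union_def)
    from e(1) show ?thesis
    proof
      assume "e \<in> arcs G"
      then have "tail G e \<in> verts G" "head G e \<in> verts G"
        using wf_digraph.tail_in_verts[OF G] wf_digraph.head_in_verts[OF G] by blast+
      then show ?thesis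
        using e(2) by auto
    next
      assume "e \<in> arcs H"
      then have "tail G e \<in> verts H" "head G e \<in> verts H"
        using wf_digraph.tail_in_verts[OF H, of e] wf_digraph.head_in_verts[OF H, of e] comp
        by (simp_all add: compatible_def)
      then show ?thesis
        using e(2) disj by auto
    qed
  qed
  have "(u, v) \<in> rtrancl_on W ((arcs_ends (union G H \<restriction> W))\<^sup>s)"
    using conn u v by (simp add: connected_conv)
  then have "v \<in> verts G"
    by (induct rule: rtrancl_on_induct) (use u cross in blast)+
  with v disj show False
    by blast
qed

text \<open>A \<open>k\<close>-set is interpolated between \<open>{u, v}\<close> and
  \<open>U\<close>; \<open>2 \<le> k\<close> leaves room for both points.\<close>

lemma ex_subset_card_meeting_both:
  assumes U: "finite U" "k \<le> card U" and k: "2 \<le> k" and "u \<in> U" "v \<in> U"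
  shows "\<exists>W\<subseteq>U. card W = k \<and> u \<in> W \<and> v \<in> W"
proof -
  have "card {u, v} \<le> k"
    using k by (cases "u = v") auto
  then obtain W where "{u, v} \<subseteq> W" "W \<subseteq> U" "card W = k"
    using exists_subset_between[of "{u, v}" k U] assms by auto
  then show ?thesis
    by blast
qed

text \<open>Subsets of \<open>U\<close> miss \<open>verts H\<close>, so the union and
  \<open>G\<close> induce the same graph on each of them.\<close>

lemma face_complements_union_sub_left:
  assumes "wf_digraph H" "compatible G H" "verts G \<inter> verts H = {}" "U \<subseteq> verts G"
  shows "U \<in> face_complements k (union G H) \<longleftrightarrow> U \<in> face_complements k G"
proof -
  have "union G H \<restriction> W = G \<restriction> W" if "W \<subseteq> U" for W
    using that assms by (intro induce_subgraph_union_left) auto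
  then show ?thesis
    using assms(4) by (auto simp: face_complements_def)
qed

lemma face_complements_union:
  assumes G: "wf_digraph G" "finite (verts G)" and H: "wf_digraph H" "finite (verts H)"
    and comp: "compatible G H" and disj: "verts G \<inter> verts H = {}" and k: "2 \<le> k"
  shows "face_complements k (union G H) = face_complements k G \<union> face_complements k H \<union>
    {U. U \<subseteq> verts G \<union> verts H \<and> k \<le> card U \<and> \<not> U \<subseteq> verts G \<and> \<not> U \<subseteq> verts H}"
    (is "?L = ?A \<union> ?B \<union> ?C")
proof (intro set_eqI)
  fix U
  have subL: "U \<subseteq> verts G \<union> verts H" if "U \<in> ?L"
    using that by (simp add: face_complements_def)
  have subA: "U \<subseteq> verts G" if "U \<in> ?A"
    using that by (simp add: face_complements_def)
  have subB: "U \<subseteq> verts H" if "U \<in> ?B"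
    using that by (simp add: face_complements_def)
  \<comment> \<open>This places a face complement that meets both sides in the third family.\<close>
  have L_card: "k \<le> card U" if "U \<in> ?L"
  proof -
    have "finite U"
      using subL[OF that] G H by (auto intro: finite_subset)
    then show ?thesis
      using that by (auto simp: face_complements_def intro: card_mono)
  qed
  \<comment> \<open>The empty set lies inside both vertex sets and would blur the cases; it contains
    no \<open>k\<close>-set because \<open>k\<close> is positive.\<close>
  have ne: "U \<noteq> {}" if "U \<in> ?A \<or> U \<in> ?B"
    using that k by (auto simp: face_complements_def)
  consider (left) "U \<subseteq> verts G" | (right) "U \<subseteq> verts H"
    | (both) "\<not> U \<subseteq> verts G" "\<not> U \<subseteq> verts H"
    by blast
  then show "U \<in> ?L \<longleftrightarrow> U \<in> ?A \<union> ?B \<union> ?C"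
  proof cases
    case left
    then have "U \<notin> ?B"
      using disj ne subB by blast
    with left show ?thesis
      using face_complements_union_sub_left[OF H(1) comp disj left] by blast
  next
    case right
    \<comment> \<open>The summands are exchanged, so that the result for the left one applies to the
      right one.\<close>
    have "compatible H G" "verts H \<inter> verts G = {}"
      using comp disj by (auto simp: compatible_def)
    then have "U \<in> ?L \<longleftrightarrow> U \<in> ?B"
      using face_complements_union_sub_left[OF G(1) _ _ right]
        union_commute_compatible[OF comp] by metis
    moreover have "U \<notin> ?A"
      using right disj ne subA by blast
    ultimately show ?thesis
      using right by blast
  next
    case both
    have "U \<in> ?L" if sub: "U \<subseteq> verts G \<union> verts H" and card: "k \<le> card U"
    proof -
      obtain u v where uv: "u \<in> U" "u \<in> verts G" "v \<in> U" "v \<in> verts H"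
        using both sub by blast
      have "finite U"
        using sub G H by (auto intro: finite_subset)
      then obtain W where W: "W \<subseteq> U" "card W = k" "u \<in> W" "v \<in> W"
        using ex_subset_card_meeting_both[OF _ card k] uv by blast
      then have "\<not> Digraph_Component.connected (union G H \<restriction> W)"
        using uv by (intro not_connected_union[OF G(1) H(1) comp disj]) auto
      with W sub show ?thesis
        by (auto simp: face_complements_def)
    qed
    then show ?thesis
      using both subL subA subB L_card by blast
  qed
qed

section \<open>Counting the sets that meet both sides\<close>

lemma card_subsets_meeting_both:
  assumes fin: "finite A" "finite B" and disj: "A \<inter> B = {}" and "0 < j"
  shows "int (card {U. U \<subseteq> A \<union> B \<and> card U = j \<and> \<not> U \<subseteq> A \<and> \<not> U \<subseteq> B}) =
    int ((card A + card B) choose j) - int (card A choose j) - int (card B choose j)"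
proof -
  let ?S = "\<lambda>X. {U. U \<subseteq> X \<and> card U = j}"
  let ?T = "{U. U \<subseteq> A \<union> B \<and> card U = j \<and> \<not> U \<subseteq> A \<and> \<not> U \<subseteq> B}"
  have finS: "finite (?S X)" if "finite X" for X :: "'a set"
    using that by simp
  have finT: "finite ?T"
    by (rule finite_subset[OF _ finS[of "A \<union> B"]]) (use fin in auto)
  have split: "?S (A \<union> B) = ?T \<union> (?S A \<union> ?S B)"
    by blast
  \<comment> \<open>Only the empty set lies in both \<open>A\<close> and \<open>B\<close>, and
    \<open>0 < j\<close> rules it out; so no correction term arises.\<close>
  have "?S A \<inter> ?S B = {}"
  proof -
    have "U \<notin> ?S B" if U: "U \<in> ?S A" for U
    proof
      assume "U \<in> ?S B"
      then have "U = {}"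
        using U disj by blast
      then show False
        using U \<open>0 < j\<close> by simp
    qed
    then show ?thesis
      by blast
  qed
  then have "card (?S A \<union> ?S B) = card (?S A) + card (?S B)"
    by (intro card_Un_disjoint finS fin)
  moreover have "card (?T \<union> (?S A \<union> ?S B)) = card ?T + card (?S A \<union> ?S B)"
    by (intro card_Un_disjoint finite_UnI finS fin finT) blast
  ultimately have "card (?S (A \<union> B)) = card ?T + (card (?S A) + card (?S B))"
    by (simp only: split)
  then show ?thesis
    using fin disj by (simp add: n_subsets card_Un_disjoint)
qed

text \<open>Grouped by cardinality, the sets have sizes from \<open>k\<close> to \<open>n\<close>;
  since \<open>0 < k\<close>, \<open>card_subsets_meeting_both\<close> gives every
  coefficient.\<close>

lemma sum_subsets_meeting_both:
  assumes fin: "finite A" "finite B" and disj: "A \<inter> B = {}" and "0 < k"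
  defines "n \<equiv> card A + card B"
  shows "(\<Sum>U | U \<subseteq> A \<union> B \<and> k \<le> card U \<and> \<not> U \<subseteq> A \<and> \<not> U \<subseteq> B. monom 1 (n - card U)) =
    (\<Sum>j = k..n. monom (int (n choose j) - int (card A choose j) - int (card B choose j)) (n - j))"
    (is "sum _ ?T = _")
proof -
  have n: "card (A \<union> B) = n"
    using fin disj by (simp add: n_def card_Un_disjoint)
  have "finite ?T"
    by (rule finite_subset[of _ "Pow (A \<union> B)"]) (use fin in auto)
  moreover have "card U \<le> n" if "U \<subseteq> A \<union> B" for U
    using card_mono[OF _ that] fin n by simp
  ultimately have "(\<Sum>U\<in>?T. monom (1::int) (n - card U)) =
      (\<Sum>j = k..n. \<Sum>U\<in>{U\<in>?T. card U = j}. monom 1 (n - card U))"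
    by (intro sum.group[symmetric]) auto
  also have "\<dots> = (\<Sum>j = k..n. monom (int (card {U\<in>?T. card U = j})) (n - j))"
    by (intro sum.cong refl) (simp add: of_nat_poly smult_monom)
  also have "\<dots> = (\<Sum>j = k..n.
      monom (int (n choose j) - int (card A choose j) - int (card B choose j)) (n - j))"
  proof (intro sum.cong refl arg_cong2[where f = monom])
    fix j assume j: "j \<in> {k..n}"
    then have "{U\<in>?T. card U = j} =
        {U. U \<subseteq> A \<union> B \<and> card U = j \<and> \<not> U \<subseteq> A \<and> \<not> U \<subseteq> B}"
      by auto
    then show "int (card {U\<in>?T. card U = j}) =
        int (n choose j) - int (card A choose j) - int (card B choose j)"
      using card_subsets_meeting_both[OF fin disj, of j] j \<open>0 < k\<close> by (simp add: n_def)
  qed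
  finally show ?thesis .
qed

section \<open>Assembling the polynomial identity\<close>

lemma monom_mult_f_polynomial_cut_complex:
  assumes fin: "finite (verts G)"
  shows "monom 1 m * f_polynomial (cut_complex k G) =
    (\<Sum>U\<in>face_complements k G. monom 1 (card (verts G) + m - card U))"
proof -
  \<comment> \<open>The factor adds \<open>m\<close> to each exponent; with truncated subtraction,
    moving \<open>m\<close> inside requires \<open>card U \<le> card (verts G)\<close>.\<close>
  have "m + (card (verts G) - card U) = card (verts G) + m - card U"
    if "U \<in> face_complements k G" for U
  proof -
    have "card U \<le> card (verts G)"
      using that fin by (auto simp: face_complements_def intro: card_mono)
    then show ?thesis
      by simp
  qed
  then show ?thesis
    by (simp add: f_polynomial_cut_complex[OF fin] sum_distrib_left mult_monom)
qed

text \<open>In the union every face complement \<open>U\<close> has weight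
  \<open>monom 1 (n - card U)\<close>. For a complement coming from one summand, this is its own
  weight shifted by the size of the other vertex set.\<close>

lemma f_polynomial_cut_complex_union:
  assumes G: "wf_digraph G" "finite (verts G)" and H: "wf_digraph H" "finite (verts H)"
    and comp: "compatible G H" and disj: "verts G \<inter> verts H = {}" and k: "2 \<le> k"
  defines "n \<equiv> card (verts G) + card (verts H)"
  shows "f_polynomial (cut_complex k (union G H)) =
    monom 1 (card (verts H)) * f_polynomial (cut_complex k G) +
    monom 1 (card (verts G)) * f_polynomial (cut_complex k H) +
    (\<Sum>j = k..n. monom (int (n choose j) - int (card (verts G) choose j) -
      int (card (verts H) choose j)) (n - j))"
proof -
  let ?A = "face_complements k G" and ?B = "face_complements k H"
  let ?T = "{U. U \<subseteq> verts G \<union> verts H \<and> k \<le> card U \<and> \<not> U \<subseteq> verts G \<and> \<not> U \<subseteq> verts H}"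
  let ?m = "\<lambda>U. monom (1::int) (n - card U)"
  have n: "card (verts (union G H)) = n"
    using G H disj by (simp add: n_def card_Un_disjoint)
  have fin: "finite ?A" "finite ?B" "finite ?T"
    using G H finite_subset[of ?T "Pow (verts G \<union> verts H)"]
    by (auto intro: finite_face_complements)
  have sub: "U \<subseteq> verts G \<and> U \<noteq> {}" if "U \<in> ?A" for U
    using that k by (auto simp: face_complements_def)
  have sub': "U \<subseteq> verts H" if "U \<in> ?B" for U
    using that by (auto simp: face_complements_def)
  \<comment> \<open>A common element of \<open>?A\<close> and \<open>?B\<close> would be empty,
    which \<open>sub\<close> excludes; \<open>?T\<close> contains no subset of either side.\<close>
  have dis: "?A \<inter> ?B = {}" "(?A \<union> ?B) \<inter> ?T = {}"
    using sub sub' disj by blast+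
  have "f_polynomial (cut_complex k (union G H)) = sum ?m (?A \<union> ?B \<union> ?T)"
    using f_polynomial_cut_complex[of "union G H" k] n G(2) H(2)
      face_complements_union[OF G H comp disj k] by simp
  also have "\<dots> = sum ?m ?A + sum ?m ?B + sum ?m ?T"
    using fin dis by (simp only: sum.union_disjoint finite_Un)
  finally show ?thesis
    using G(2) H(2) k sum_subsets_meeting_both[OF G(2) H(2) disj, of k]
    by (simp add: monom_mult_f_polynomial_cut_complex n_def add.commute)
qed

theorem theorem3p8:
  fixes G\<^sub>1 G\<^sub>2 :: "'a pair_pre_digraph" and k n\<^sub>1 n\<^sub>2 :: nat
  assumes "k \<ge> 2"
    and "pair_graph G\<^sub>1" and "pair_graph G\<^sub>2"
    and "pverts G\<^sub>1 \<inter> pverts G\<^sub>2 = {}"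
    and "n\<^sub>1 = card (pverts G\<^sub>1)" and "n\<^sub>2 = card (pverts G\<^sub>2)"
    and "n\<^sub>1 \<ge> 1" and "n\<^sub>2 \<ge> 1"
  shows "f_polynomial (cut_complex k (union (with_proj G\<^sub>1) (with_proj G\<^sub>2))) =
    monom 1 n\<^sub>2 * f_polynomial (cut_complex k (with_proj G\<^sub>1)) +
    monom 1 n\<^sub>1 * f_polynomial (cut_complex k (with_proj G\<^sub>2)) +
    (\<Sum>j = k..n\<^sub>1 + n\<^sub>2.
       monom (int ((n\<^sub>1 + n\<^sub>2) choose j) - int (n\<^sub>1 choose j) - int (n\<^sub>2 choose j))
         (n\<^sub>1 + n\<^sub>2 - j))"
proof -
  interpret G1: pair_graph G\<^sub>1 by fact
  interpret G2: pair_graph G\<^sub>2 by fact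
  show ?thesis
    using f_polynomial_cut_complex_union[of "with_proj G\<^sub>1" "with_proj G\<^sub>2" k]
      G1.wf_digraph G2.wf_digraph assms
    \<comment> \<open>\<open>with_proj\<close> uses \<open>fst\<close> and \<open>snd\<close> as end
      maps for both graphs, so they are compatible.\<close>
    by (simp add: compatible_def)
qed

end
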